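(* Let $G$ be a connected graph on $n$ vertices with maximum degree $\Delta(G)=n-1$, and let $H$ be a graph with $n\ge s(H)$. Let $r=R(G,H)$. If $r\le (\chi(H)-1)n+s(H)-1$, then $$R_{\pi}(G,H)\le \big[r-(\chi(H)-1)(n-1)-s(H)+1\big]\,n-1.$$ In particular, if $G$ is $H$-good, then $R_{\pi}(G,H)\le n-1$.
   Context: All graphs are finite and simple. For graphs $F,G,H$, write $F\rightarrow(G,H)$ if every red-blue coloring of the edges of $F$ contains a red copy of $G$ or a blue copy of $H$. The Ramsey number $R(G,H)$ is the smallest $r$ with $K_r\rightarrow(G,H)$. For a graph $F$ with $|V(F)|\le r$, $K_r\setminus F$ denotes the graph obtained from $K_r$ by deleting the edges of a copy of $F$. $P_k$ is the path on $k$ vertices. The path-critical Ramsey number is $R_{\pi}(G,H)=\max\{k: K_r\setminus P_k\rightarrow(G,H)\}$ where $r=R(G,H)$. $\chi(H)$ is the chromatic number of $H$, and $s(H)$ (the chromatic surplus) is the minimum size of a color class over all proper vertex colorings of $H$ with $\chi(H)$ colors. A connected graph $G$ on $n\ge s(H)$ vertices is called $H$-good if $R(G,H)=(\chi(H)-1)(n-1)+s(H)$.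
   Formalization: Assumes n ≥ 2: for n = 1 (G = K_1) the stated bound is 0 while R_π(G,H) = 1, so the claim fails. The "in particular" part is read under the hypothesis r ≤ (χ(H)-1)n+s(H)-1, i.e. χ(H) ≥ 2 for H-good G; it fails for H = n isolated vertices. *)

theory Defs
  imports Main "HOL-Library.Ramsey"
begin

type_synonym 'a ugraph = "'a set \<times> 'a set set"

abbreviation verts :: "'a ugraph \<Rightarrow> 'a set" where "verts G \<equiv> fst G"
abbreviation edges :: "'a ugraph \<Rightarrow> 'a set set" where "edges G \<equiv> snd G"

text \<open>Finite simple graphs, with at least one vertex; the edges are two-element sets of vertices.\<close>

definition ugraph :: "'a ugraph \<Rightarrow> bool" where
  "ugraph G \<longleftrightarrow> finite (verts G) \<and> verts G \<noteq> {} \<and> edges G \<subseteq> nsets (verts G) 2"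

definition ugraph_connected :: "'a ugraph \<Rightarrow> bool" where
  "ugraph_connected G \<longleftrightarrow>
     (\<forall>u\<in>verts G. \<forall>v\<in>verts G. (u, v) \<in> {(x, y). {x, y} \<in> edges G}\<^sup>*)"

definition degree :: "'a ugraph \<Rightarrow> 'a \<Rightarrow> nat" where
  "degree G v = card {e \<in> edges G. v \<in> e}"

definition max_degree :: "'a ugraph \<Rightarrow> nat" where
  "max_degree G = Max (degree G ` verts G)"

definition complete_graph :: "nat \<Rightarrow> nat ugraph" where
  "complete_graph r = ({..<r}, nsets {..<r} 2)"

definition path_graph :: "nat \<Rightarrow> nat ugraph" where
  "path_graph k = ({..<k}, {{i, Suc i} | i. Suc i < k})"

definition delete_edges :: "'a ugraph \<Rightarrow> 'a ugraph \<Rightarrow> 'a ugraph" where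
  "delete_edges F F' = (verts F, edges F - edges F')"

definition contains_copy :: "'a ugraph \<Rightarrow> 'b ugraph \<Rightarrow> bool" where
  "contains_copy F G \<longleftrightarrow>
     (\<exists>f. inj_on f (verts G) \<and> f ` verts G \<subseteq> verts F \<and> (\<forall>e\<in>edges G. f ` e \<in> edges F))"

datatype colour = Red | Blue

definition colour_subgraph :: "'a ugraph \<Rightarrow> ('a set \<Rightarrow> colour) \<Rightarrow> colour \<Rightarrow> 'a ugraph" where
  "colour_subgraph F c x = (verts F, {e \<in> edges F. c e = x})"

definition arrows :: "'a ugraph \<Rightarrow> 'b ugraph \<Rightarrow> 'c ugraph \<Rightarrow> bool" where
  "arrows F G H \<longleftrightarrow>
     (\<forall>c. contains_copy (colour_subgraph F c Red) G \<or> contains_copy (colour_subgraph F c Blue) H)"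

definition ramsey_number :: "'a ugraph \<Rightarrow> 'b ugraph \<Rightarrow> nat" where
  "ramsey_number G H = (LEAST r. arrows (complete_graph r) G H)"

text \<open>For \<open>k \<le> r\<close> the graph \<open>path_graph k\<close> is itself a subgraph of \<open>complete_graph r\<close>, and any two
  copies of it there are exchanged by a permutation of the vertices, so it serves as the copy whose
  edges are deleted.\<close>

definition path_critical_ramsey :: "'a ugraph \<Rightarrow> 'b ugraph \<Rightarrow> nat" where
  "path_critical_ramsey G H =
     (let r = ramsey_number G H in
      Max {k. 1 \<le> k \<and> k \<le> r \<and> arrows (delete_edges (complete_graph r) (path_graph k)) G H})"

definition proper_colouring :: "'a ugraph \<Rightarrow> nat \<Rightarrow> ('a \<Rightarrow> nat) \<Rightarrow> bool" where
  "proper_colouring H k c \<longleftrightarrow>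
     c ` verts H \<subseteq> {..<k} \<and> (\<forall>u v. {u, v} \<in> edges H \<longrightarrow> c u \<noteq> c v)"

definition chromatic_number :: "'a ugraph \<Rightarrow> nat" where
  "chromatic_number H = (LEAST k. \<exists>c. proper_colouring H k c)"

definition chromatic_surplus :: "'a ugraph \<Rightarrow> nat" where
  "chromatic_surplus H =
     (LEAST m. \<exists>c i. proper_colouring H (chromatic_number H) c \<and> i < chromatic_number H \<and>
        m = card {v \<in> verts H. c v = i})"

definition good :: "'a ugraph \<Rightarrow> 'b ugraph \<Rightarrow> bool" where
  "good G H \<longleftrightarrow>
     ugraph_connected G \<and> chromatic_surplus H \<le> card (verts G) \<and>
     ramsey_number G H =
       (chromatic_number H - 1) * (card (verts G) - 1) + chromatic_surplus H"

end

theory Submission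
  imports Defs
begin

text \<open>
  Write \<open>\<chi>\<close>, \<open>s\<close> for the chromatic number and surplus of \<open>H\<close>. Split \<open>K\<^sub>r\<close> into \<open>t\<close> parts of size \<open>n\<close>,
  further parts of size \<open>n - 1\<close> and a last one of size less than \<open>s\<close>, \<open>\<chi>\<close> parts in all; colour edges
  inside a part red and edges between parts blue. A blue copy of \<open>H\<close> would have a proper
  \<open>\<chi>\<close>-colouring with a class smaller than \<open>s\<close>. Deleting a path that runs through all parts of size \<open>n\<close>
  removes an edge at each of their vertices, so no vertex has red degree \<open>n - 1\<close> and there is no red
  copy of \<open>G\<close>. Taking \<open>t = 0\<close> gives \<open>r \<ge> (\<chi> - 1)(n - 1) + s\<close>; taking
  \<open>t = r - (\<chi> - 1)(n - 1) - s + 1\<close> gives the bound.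
\<close>

section \<open>Positivity of the chromatic number and the chromatic surplus\<close>

lemma ex_proper_colouring:
  assumes "ugraph H"
  shows "\<exists>c. proper_colouring H (chromatic_number H) c"
proof -
  obtain c where c: "bij_betw c (verts H) {0..<card (verts H)}"
    using assms ex_bij_betw_finite_nat unfolding ugraph_def by blast
  have "c u \<noteq> c v" if "{u, v} \<in> edges H" for u v
  proof -
    have "{u, v} \<in> nsets (verts H) 2"
      using that assms unfolding ugraph_def by blast
    then show ?thesis
      using c unfolding bij_betw_def inj_on_def by auto
  qed
  then have "proper_colouring H (card (verts H)) c"
    using c unfolding proper_colouring_def bij_betw_def by auto
  then show ?thesis
    unfolding chromatic_number_def
    using LeastI[of "\<lambda>k. \<exists>c. proper_colouring H k c"] by blast
qed

lemma chromatic_number_pos: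
  assumes "ugraph H"
  shows "chromatic_number H > 0"
  using ex_proper_colouring[OF assms] assms
  unfolding proper_colouring_def ugraph_def by auto

lemma chromatic_surplus_le:
  assumes "proper_colouring H (chromatic_number H) c" "i < chromatic_number H"
  shows "chromatic_surplus H \<le> card {v \<in> verts H. c v = i}"
  unfolding chromatic_surplus_def using assms by (intro Least_le) blast

text \<open>An empty class would free a colour: moving the top colour there leaves a proper
  colouring with one colour fewer, against minimality.\<close>

lemma chromatic_surplus_pos:
  assumes H: "ugraph H"
  shows "chromatic_surplus H > 0"
proof (rule ccontr)
  let ?k = "chromatic_number H"
  assume "\<not> chromatic_surplus H > 0"
  moreover obtain c0 where "proper_colouring H ?k c0"
    using ex_proper_colouring[OF H] by blast
  then have "\<exists>m c i. proper_colouring H ?k c \<and> i < ?k \<and> m = card {v \<in> verts H. c v = i}"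
    using chromatic_number_pos[OF H] by blast
  then have "\<exists>c i. proper_colouring H ?k c \<and> i < ?k \<and>
      chromatic_surplus H = card {v \<in> verts H. c v = i}"
    unfolding chromatic_surplus_def by (rule LeastI_ex)
  ultimately obtain c i where c: "proper_colouring H ?k c" and i: "i < ?k"
    and "card {v \<in> verts H. c v = i} = 0"
    by auto
  then have unused: "c v \<noteq> i" if "v \<in> verts H" for v
    using that H unfolding ugraph_def by auto
  \<comment> \<open>If \<open>i\<close> is itself the top colour, then \<open>c'\<close> is just
    \<open>c\<close>, which avoids that colour on the vertices.\<close>
  define c' where "c' v = (if c v = ?k - 1 then i else c v)" for v
  have "proper_colouring H (?k - 1) c'"
    unfolding proper_colouring_def
  proof (intro conjI allI impI)
    show "c' ` verts H \<subseteq> {..<?k - 1}"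
    proof
      fix x assume "x \<in> c' ` verts H"
      then obtain v where v: "v \<in> verts H" "x = c' v" by blast
      then have "c v < ?k" "c v \<noteq> i"
        using c unused unfolding proper_colouring_def by auto
      then show "x \<in> {..<?k - 1}"
        using i unfolding v(2) c'_def by auto
    qed
  next
    fix u v assume e: "{u, v} \<in> edges H"
    then have "{u, v} \<in> nsets (verts H) 2"
      using H unfolding ugraph_def by blast
    then have "c u \<noteq> i" "c v \<noteq> i"
      using unused by auto
    moreover have "c u \<noteq> c v"
      using e c unfolding proper_colouring_def by blast
    ultimately show "c' u \<noteq> c' v"
      unfolding c'_def by auto
  qed
  then have "?k \<le> ?k - 1"
    unfolding chromatic_number_def by (intro Least_le) blast
  then show False
    using i by linarith
qed

section \<open>Partition colourings with no red \<open>G\<close> and no blue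
  \<open>H\<close>\<close>

lemma ex_universal_vertex:
  assumes G: "ugraph G" and deg: "max_degree G = card (verts G) - 1"
  shows "\<exists>w\<in>verts G. \<forall>x\<in>verts G - {w}. {w, x} \<in> edges G"
proof -
  have fin: "finite (verts G)" and ne: "verts G \<noteq> {}" and sub: "edges G \<subseteq> nsets (verts G) 2"
    using G unfolding ugraph_def by auto
  have "Max (degree G ` verts G) \<in> degree G ` verts G"
    using fin ne by simp
  then obtain w where w: "w \<in> verts G" "degree G w = card (verts G) - 1"
    using deg unfolding max_degree_def by auto
  let ?N = "{x \<in> verts G. {w, x} \<in> edges G}"
  have "{e \<in> edges G. w \<in> e} \<subseteq> (\<lambda>x. {w, x}) ` ?N"
  proof
    fix e assume e: "e \<in> {e \<in> edges G. w \<in> e}"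
    then have "e \<in> nsets (verts G) 2" using sub by blast
    then obtain x y where "e = {x, y}" "x \<in> verts G" "y \<in> verts G"
      by (rule nsets2_E)
    with e show "e \<in> (\<lambda>x. {w, x}) ` ?N"
      by (auto simp: insert_commute)
  qed
  then have "degree G w \<le> card ?N"
    unfolding degree_def using fin by (intro surj_card_le) auto
  \<comment> \<open>The set \<open>{w, w}\<close> is a singleton, hence no edge, so \<open>w\<close>
    is not in \<open>?N\<close>.\<close>
  moreover have "?N \<subseteq> verts G - {w}"
    using subsetD[OF sub, of "{w, w}"] by (auto simp: nsets_def)
  ultimately have "?N = verts G - {w}"
    using w fin by (intro card_seteq) auto
  then show ?thesis
    using w(1) by blast
qed

text \<open>Edges inside the parts given by \<open>p\<close> are red, those between parts blue. A
  red \<open>G\<close> needs a vertex with \<open>card (verts G) - 1\<close> red neighbours as the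
  image of \<open>w\<close>. In a blue \<open>H\<close> the parts are colour classes, and class
  \<open>i\<close> is too small.\<close>

lemma not_arrows_partition:
  fixes F :: "'c ugraph"
  assumes H: "ugraph H" and G: "finite (verts G)" and F: "finite (verts F)"
    and w: "w \<in> verts G" "\<forall>x\<in>verts G - {w}. {w, x} \<in> edges G"
    and p: "\<And>v. v \<in> verts F \<Longrightarrow> p v < chromatic_number H"
    and i: "i < chromatic_number H" "card {v \<in> verts F. p v = i} < chromatic_surplus H"
    and red: "\<And>v. v \<in> verts F \<Longrightarrow>
      card {u \<in> verts F. u \<noteq> v \<and> p u = p v \<and> {v, u} \<in> edges F} < card (verts G) - 1"
  shows "\<not> arrows F G H"
proof -
  define c where "c e = (if \<exists>u v. e = {u, v} \<and> p u = p v then Red else Blue)" for e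
  have c_iff: "c {u, v} = Red \<longleftrightarrow> p u = p v" for u v
    unfolding c_def by (auto simp: doubleton_eq_iff)
  have "\<not> contains_copy (colour_subgraph F c Red) G"
  proof
    assume "contains_copy (colour_subgraph F c Red) G"
    then obtain f where f: "inj_on f (verts G)" "f ` verts G \<subseteq> verts F"
      "\<And>e. e \<in> edges G \<Longrightarrow> f ` e \<in> edges F \<and> c (f ` e) = Red"
      unfolding contains_copy_def colour_subgraph_def by auto
    have "f ` (verts G - {w}) \<subseteq> {u \<in> verts F. u \<noteq> f w \<and> p u = p (f w) \<and> {f w, u} \<in> edges F}"
    proof
      fix y assume "y \<in> f ` (verts G - {w})"
      then obtain x where x: "x \<in> verts G" "x \<noteq> w" "y = f x" by blast
      then have "f ` {w, x} \<in> edges F \<and> c (f ` {w, x}) = Red"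
        using w(2) f(3) by blast
      then show "y \<in> {u \<in> verts F. u \<noteq> f w \<and> p u = p (f w) \<and> {f w, u} \<in> edges F}"
        using x f(1,2) w(1) by (auto simp: c_iff inj_on_def)
    qed
    then have "card (f ` (verts G - {w}))
        \<le> card {u \<in> verts F. u \<noteq> f w \<and> p u = p (f w) \<and> {f w, u} \<in> edges F}"
      using F by (intro card_mono) auto
    moreover have "card (f ` (verts G - {w})) = card (verts G) - 1"
      using f(1) w(1) G by (simp add: card_image inj_on_diff)
    ultimately show False
      using red[of "f w"] f(2) w(1) by auto
  qed
  moreover have "\<not> contains_copy (colour_subgraph F c Blue) H"
  proof
    assume "contains_copy (colour_subgraph F c Blue) H"
    then obtain f where f: "inj_on f (verts H)" "f ` verts H \<subseteq> verts F"
      "\<And>e. e \<in> edges H \<Longrightarrow> f ` e \<in> edges F \<and> c (f ` e) = Blue"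
      unfolding contains_copy_def colour_subgraph_def by auto
    have "p (f u) \<noteq> p (f v)" if "{u, v} \<in> edges H" for u v
      using f(3)[OF that] c_iff[of "f u" "f v"] by auto
    then have "proper_colouring H (chromatic_number H) (p \<circ> f)"
      using f(2) p unfolding proper_colouring_def by auto
    then have "chromatic_surplus H \<le> card {v \<in> verts H. (p \<circ> f) v = i}"
      using i(1) by (rule chromatic_surplus_le)
    also have "\<dots> = card (f ` {v \<in> verts H. (p \<circ> f) v = i})"
      using f(1) by (intro card_image[symmetric]) (auto simp: inj_on_def)
    also have "\<dots> \<le> card {v \<in> verts F. p v = i}"
      using f(2) F by (intro card_mono) auto
    finally show False
      using i(2) by linarith
  qed
  ultimately show ?thesis
    unfolding arrows_def by blast
qed

text \<open>The path visits every vertex of the \<open>t\<close> parts of size \<open>n\<close>,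
  which are the only ones where a red degree could reach \<open>n - 1\<close>. Only an upper bound
  on \<open>r\<close> is imposed: a smaller \<open>r\<close> truncates the parts. With
  \<open>t = k = 0\<close> nothing is deleted.\<close>

lemma not_arrows_delete_path:
  fixes n r t k :: nat
  assumes H: "ugraph H" and G: "finite (verts G)" "card (verts G) = n" "n \<ge> 2"
    and w: "w \<in> verts G" "\<forall>x\<in>verts G - {w}. {w, x} \<in> edges G"
    and s: "chromatic_surplus H \<le> n"
    and t: "t < chromatic_number H" "t * n \<le> k"
    and r: "r < t * n + (chromatic_number H - 1 - t) * (n - 1) + chromatic_surplus H"
  shows "\<not> arrows (delete_edges (complete_graph r) (path_graph k)) G H"
proof -
  let ?F = "delete_edges (complete_graph r) (path_graph k)"
  define m where "m = n - 1"
  have m: "0 < m" "n = Suc m" using G(3) unfolding m_def by auto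
  define a where "a = (chromatic_number H - 1 - t) * m"
  \<comment> \<open>The parts are intervals: \<open>t\<close> of length \<open>n\<close>, then
    intervals of length \<open>m\<close>. Part \<open>chromatic_number H - 1\<close> starts at
    \<open>t * n + a\<close> and is the small one.\<close>
  define p where "p v = (if v < t * n then v div n else t + (v - t * n) div m)" for v
  have vF: "verts ?F = {..<r}"
    by (simp add: delete_edges_def complete_graph_def)
  have small: "p v < t" if "v < t * n" for v
    using that m(2) unfolding p_def by (simp add: less_mult_imp_div_less)
  have large: "p v = t + (v - t * n) div m" if "\<not> v < t * n" for v
    using that unfolding p_def by simp
  have pos: "chromatic_surplus H > 0"
    using H by (rule chromatic_surplus_pos)
  show ?thesis
  proof (rule not_arrows_partition[OF H G(1) _ w, where p = p and i = "chromatic_number H - 1"])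
    show "finite (verts ?F)" by (simp add: vF)
  next
    fix v assume "v \<in> verts ?F"
    then have "v < r" by (simp add: vF)
    show "p v < chromatic_number H"
    proof (cases "v < t * n")
      case True
      then show ?thesis using small[OF True] t by linarith
    next
      case False
      \<comment> \<open>The last part has fewer than \<open>chromatic_surplus H\<close> \<le>
        \<open>n\<close> vertices, hence at most \<open>m\<close>, so no further part
        begins.\<close>
      then have "v - t * n < a + m"
        using \<open>v < r\<close> r s pos m unfolding a_def m_def by linarith
      moreover have "chromatic_number H - t = Suc (chromatic_number H - 1 - t)"
        using t(1) by linarith
      then have "a + m = (chromatic_number H - t) * m"
        unfolding a_def by simp
      ultimately have "(v - t * n) div m < chromatic_number H - t"
        by (simp add: less_mult_imp_div_less)
      then show ?thesis using large[OF False] t by linarith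
    qed
  next
    show "chromatic_number H - 1 < chromatic_number H"
      using t by linarith
  next
    have "{v \<in> verts ?F. p v = chromatic_number H - 1} \<subseteq> {t * n + a..<r}"
    proof
      fix v assume "v \<in> {v \<in> verts ?F. p v = chromatic_number H - 1}"
      then have v: "v < r" "p v = chromatic_number H - 1" by (auto simp: vF)
      have ge: "\<not> v < t * n" using small[of v] v(2) t(1) by linarith
      then have "(v - t * n) div m = chromatic_number H - 1 - t"
        using large[OF ge] v(2) by linarith
      then have "a \<le> v - t * n"
        unfolding a_def by (metis div_times_less_eq_dividend)
      then show "v \<in> {t * n + a..<r}" using v ge by auto
    qed
    then have "card {v \<in> verts ?F. p v = chromatic_number H - 1} \<le> card {t * n + a..<r}"
      by (intro card_mono) auto
    then show "card {v \<in> verts ?F. p v = chromatic_number H - 1} < chromatic_surplus H"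
      using r pos unfolding a_def m_def by simp
  next
    fix v assume "v \<in> verts ?F"
    let ?S = "{u \<in> verts ?F. u \<noteq> v \<and> p u = p v \<and> {v, u} \<in> edges ?F}"
    show "card ?S < card (verts G) - 1"
    proof (cases "v < t * n")
      case True
      define q where "q = v div n"
      have q: "q * n \<le> v" "v < q * n + n"
        using dividend_less_div_times[of n v] G(3) unfolding q_def by auto
      have "(q + 1) * n \<le> t * n"
        using small[OF True] True unfolding p_def q_def by (intro mult_le_mono1) simp
      then have qt: "q * n + n \<le> t * n" by simp
      \<comment> \<open>A path neighbour of \<open>v\<close> in its own part: the predecessor, or
        the successor if \<open>v\<close> comes first. It exists because \<open>n\<close> \<ge>
        2.\<close>
      define u where "u = (if v = q * n then Suc v else v - 1)"
      have u: "u \<noteq> v" "u \<in> {q * n..<q * n + n}"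
        using q G(3) unfolding u_def by auto
      have "{v, u} \<in> edges (path_graph k)"
      proof (cases "v = q * n")
        case True
        then have "Suc v < k" using qt t(2) G(3) by linarith
        then show ?thesis using True unfolding path_graph_def u_def by auto
      next
        case False
        then have "Suc (v - 1) = v" using q by linarith
        moreover from this have "Suc (v - 1) < k" using True t(2) by linarith
        ultimately show ?thesis
          using False unfolding path_graph_def u_def
          by (auto intro!: exI[of _ "v - 1"])
      qed
      \<comment> \<open>Of the \<open>n\<close> vertices in the interval, \<open>v\<close> itself
        and \<open>u\<close>, whose edge to \<open>v\<close> is deleted, drop out.\<close>
      have "?S \<subseteq> {q * n..<q * n + n} - {v, u}"
      proof
        fix x assume x: "x \<in> ?S"
        have xt: "x < t * n"
          using x small[OF True] large[of x] by fastforce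
        have "x div n = q"
          using x xt True unfolding p_def q_def by auto
        then have "q * n \<le> x" "x < q * n + n"
          using dividend_less_div_times[of n x] div_times_less_eq_dividend[of x n] G(3) by auto
        moreover have "x \<noteq> u"
          using x \<open>{v, u} \<in> edges (path_graph k)\<close> by (auto simp: delete_edges_def)
        ultimately show "x \<in> {q * n..<q * n + n} - {v, u}"
          using x by auto
      qed
      then have "card ?S \<le> card ({q * n..<q * n + n} - {v, u})"
        by (intro card_mono) auto
      also have "\<dots> = n - 2"
        using u q by (subst card_Diff_subset) auto
      finally show ?thesis using G(2,3) by linarith
    next
      case False
      \<comment> \<open>The start of the interval of length \<open>m\<close> containing
        \<open>v\<close>. It leaves at most \<open>m - 1\<close> red neighbours, whatever is
        deleted.\<close>
      define b where "b = t * n + (v - t * n) div m * m"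
      have mem: "x \<in> {b..<b + m}" if "\<not> x < t * n" "p x = p v" for x
      proof -
        have d: "(x - t * n) div m = (v - t * n) div m"
          using that large[of x] large[OF False] by simp
        have "(x - t * n) div m * m \<le> x - t * n" "x - t * n < (x - t * n) div m * m + m"
          using dividend_less_div_times[OF m(1), of "x - t * n"] by auto
        then show ?thesis
          using that(1) unfolding b_def d by auto
      qed
      have "?S \<subseteq> {b..<b + m} - {v}"
      proof
        fix x assume x: "x \<in> ?S"
        then have "\<not> x < t * n"
          using small[of x] large[OF False] by auto
        then show "x \<in> {b..<b + m} - {v}"
          using x mem by blast
      qed
      then have "card ?S \<le> card ({b..<b + m} - {v})"
        by (intro card_mono) auto
      also have "\<dots> = m - 1"
        using mem[OF False] by simp
      finally show ?thesis using G(2) m by linarith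
    qed
  qed
qed

section \<open>Existence of the Ramsey number, and the bound\<close>

text \<open>This makes the \<open>LEAST\<close> in \<open>ramsey_number\<close> attained. Ramsey's
  theorem for the red edges gives a monochromatic complete graph on as many vertices as
  \<open>G\<close> or \<open>H\<close>, and it contains that graph.\<close>

lemma ex_arrows_complete_graph:
  assumes G: "ugraph G" and H: "ugraph H"
  shows "\<exists>r. arrows (complete_graph r) G H"
proof -
  obtain r :: nat where r: "\<forall>(V :: nat set) E. finite V \<and> card V \<ge> r \<longrightarrow>
      (\<exists>R\<subseteq>V. card R = card (verts G) \<and> clique R E \<or> card R = card (verts H) \<and> indep R E)"
    using ramsey2[of "card (verts G)" "card (verts H)"] by blast
  have copy: "contains_copy (colour_subgraph (complete_graph r) c x) K"
    if K: "ugraph K" and R: "R \<subseteq> {..<r}" "card R = card (verts K)"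
      and col: "\<And>v w. v \<in> R \<Longrightarrow> w \<in> R \<Longrightarrow> v \<noteq> w \<Longrightarrow> c {v, w} = x"
    for K :: "'c ugraph" and R c x
  proof -
    have "finite R" using R(1) finite_subset by blast
    then obtain f where f: "bij_betw f (verts K) R"
      using K R(2) finite_same_card_bij[of "verts K" R] unfolding ugraph_def by auto
    have "f ` e \<in> nsets {..<r} 2 \<and> c (f ` e) = x" if "e \<in> edges K" for e
    proof -
      have "e \<in> nsets (verts K) 2"
        using that K unfolding ugraph_def by blast
      then obtain a b where "e = {a, b}" "a \<in> verts K" "b \<in> verts K" "a \<noteq> b"
        by (rule nsets2_E)
      moreover from this have "f a \<in> R" "f b \<in> R" "f a \<noteq> f b"
        using f unfolding bij_betw_def inj_on_def by auto
      ultimately show ?thesis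
        using R(1) col by auto
    qed
    then show ?thesis
      using f R(1) unfolding contains_copy_def colour_subgraph_def complete_graph_def bij_betw_def
      by auto
  qed
  have "arrows (complete_graph r) G H"
    unfolding arrows_def
  proof
    fix c
    obtain R where R: "R \<subseteq> {..<r}" "card R = card (verts G) \<and> clique R {e. c e = Red} \<or>
        card R = card (verts H) \<and> indep R {e. c e = Red}"
      using r[rule_format, of "{..<r}" "{e. c e = Red}"] by auto
    have blue: "c e = Blue" if "c e \<noteq> Red" for e
      using that by (cases "c e") auto
    from R(2) show "contains_copy (colour_subgraph (complete_graph r) c Red) G \<or>
        contains_copy (colour_subgraph (complete_graph r) c Blue) H"
    proof
      assume "card R = card (verts G) \<and> clique R {e. c e = Red}"
      then show ?thesis
        using copy[OF G R(1), of c Red] unfolding clique_def by auto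
    next
      assume "card R = card (verts H) \<and> indep R {e. c e = Red}"
      then show ?thesis
        using copy[OF H R(1), of c Blue] blue unfolding indep_def by auto
    qed
  qed
  then show ?thesis ..
qed

lemma delete_edges_path_graph_le_1:
  assumes "k \<le> 1"
  shows "delete_edges (complete_graph r) (path_graph k) = complete_graph r"
  using assms by (auto simp: delete_edges_def path_graph_def complete_graph_def)

theorem theorem1:
  fixes G :: "'a ugraph" and H :: "'b ugraph" and n r :: nat
  assumes "ugraph G" and "ugraph_connected G"
    and "card (verts G) = n" and "n \<ge> 2"
    and "max_degree G = n - 1"
    and "ugraph H"
    and "n \<ge> chromatic_surplus H"
    and "r = ramsey_number G H"
    and "int r \<le> (int (chromatic_number H) - 1) * int n + int (chromatic_surplus H) - 1"
  shows "int (path_critical_ramsey G H)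
           \<le> (int r - (int (chromatic_number H) - 1) * (int n - 1)
                - int (chromatic_surplus H) + 1) * int n - 1
         \<and> (good G H \<longrightarrow> path_critical_ramsey G H \<le> n - 1)"
proof -
  let ?x = "chromatic_number H" and ?s = "chromatic_surplus H"
  let ?D = "\<lambda>k. delete_edges (complete_graph r) (path_graph k)"
  obtain w where w: "w \<in> verts G" "\<forall>x\<in>verts G - {w}. {w, x} \<in> edges G"
    using ex_universal_vertex[of G] assms(1,3,5) by blast
  have fin: "finite (verts G)"
    using assms(1) unfolding ugraph_def by blast
  note not_arrows = not_arrows_delete_path[OF assms(6) fin assms(3,4) w assms(7)]
  have x: "?x > 0" and s: "?s > 0"
    using assms(6) by (rule chromatic_number_pos, rule chromatic_surplus_pos)
  have arr: "arrows (complete_graph r) G H"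
    using LeastI_ex[OF ex_arrows_complete_graph[OF assms(1,6)]]
    unfolding assms(8) ramsey_number_def .
  \<comment> \<open>The partition without large parts (\<open>t = 0\<close>) and without deletion
    (\<open>k = 0\<close>) would refute \<open>arr\<close>.\<close>
  have lower: "(?x - 1) * (n - 1) + ?s \<le> r"
  proof (rule ccontr)
    assume "\<not> (?x - 1) * (n - 1) + ?s \<le> r"
    then have "\<not> arrows (?D 0) G H"
      using x by (intro not_arrows[of 0]) auto
    then show False
      using arr by (simp add: delete_edges_path_graph_le_1)
  qed
  \<comment> \<open>The bracket of the claimed bound. By \<open>lower\<close> the subtraction is not
    truncated.\<close>
  define t where "t = r + 1 - ((?x - 1) * (n - 1) + ?s)"
  have r: "r + 1 = (?x - 1) * (n - 1) + ?s + t"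
    using lower unfolding t_def by simp
  have t_int: "int r - (int ?x - 1) * (int n - 1) - int ?s + 1 = int t"
  proof -
    have "int r + 1 = (int ?x - 1) * (int n - 1) + int ?s + int t"
      using arg_cong[OF r, of int] x assms(4) by (simp add: of_nat_diff)
    then show ?thesis by linarith
  qed
  \<comment> \<open>The assumed upper bound on \<open>r\<close> says exactly that \<open>t\<close>
    large parts still leave room for the small last one.\<close>
  have "int t \<le> int ?x - 1"
    using assms(9) t_int by (simp add: algebra_simps)
  then have t: "t < ?x"
    by linarith
  \<comment> \<open>Enlarging \<open>t\<close> parts from \<open>n - 1\<close> to \<open>n\<close>
    adds \<open>t\<close> vertices, so \<open>r\<close> is the largest value that
    \<open>not_arrows\<close> allows.\<close>
  have "(?x - 1) * (n - 1) + t = t * n + (?x - 1 - t) * (n - 1)"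
  proof -
    obtain d where "?x = t + d + 1"
      using t using less_imp_Suc_add by fastforce
    moreover obtain m where "n = Suc m"
      using assms(4) by (cases n) auto
    ultimately show ?thesis
      by (simp add: algebra_simps)
  qed
  then have "r < t * n + (?x - 1 - t) * (n - 1) + ?s"
    using r by linarith
  then have upper: "k < t * n" if "arrows (?D k) G H" for k
    using that not_arrows[OF t, of k r] by (meson not_le)
  let ?K = "{k. 1 \<le> k \<and> k \<le> r \<and> arrows (?D k) G H}"
  \<comment> \<open>A one-vertex path has no edges, so \<open>?K\<close> is nonempty and its
    \<open>Max\<close> is a member.\<close>
  have "1 \<in> ?K"
    using arr lower s by (simp add: delete_edges_path_graph_le_1)
  moreover have "finite ?K"
    by (rule finite_subset[of _ "{..r}"]) auto
  ultimately have "Max ?K \<in> ?K"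
    by (intro Max_in) auto
  then have "path_critical_ramsey G H < t * n"
    using upper unfolding path_critical_ramsey_def Let_def assms(8)[symmetric] by blast
  \<comment> \<open>Goodness is equality in \<open>lower\<close>, and the strict bound
    \<open>t * n\<close> becomes \<open>n\<close>.\<close>
  moreover have "t = 1" if "good G H"
    using that r assms(3,8) unfolding good_def by simp
  ultimately show ?thesis
    unfolding t_int by (auto simp flip: of_nat_mult)
qed

end
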